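(* Let $R_1$ and $R_2$ be two commutative rings with nonzero identity and let $R=R_1\times R_2$ be their direct product. The following statements are equivalent. (1) $R$ is an $OAF$-ring. (2) $R$ is a general $ZPI$-ring. (3) $R_1$ and $R_2$ are general $ZPI$-rings.
   Context: All rings are commutative with nonzero identity. An ideal $I$ of a ring $R$ is proper if $I\neq R$. A proper ideal $I$ of $R$ is an $OA$-ideal ($1$-absorbing prime ideal) if whenever $a,b,c\in R$ are nonunits with $abc\in I$, then $ab\in I$ or $c\in I$. A ring is an $OAF$-ring if every proper ideal is a finite product (of at least one factor) of $OA$-ideals. A ring is a general $ZPI$-ring if every proper ideal is a finite product of prime ideals. *)

theory Defs
  imports "HOL-Algebra.Algebra"
begin

locale nonzero_cring = cring +
  assumes one_not_zero: "\<one> \<noteq> \<zero>"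

text \<open>OA abbreviates 1-absorbing prime. The nonunits of the ring are \<^term>\<open>carrier R - Units R\<close>.\<close>
locale OA_ideal = ideal + cring +
  assumes I_notcarr: "carrier R \<noteq> I"
    and I_absorbing: "\<lbrakk>a \<in> carrier R - Units R; b \<in> carrier R - Units R; c \<in> carrier R - Units R;
           a \<otimes> b \<otimes> c \<in> I\<rbrakk> \<Longrightarrow> a \<otimes> b \<in> I \<or> c \<in> I"

text \<open>The list is required to be nonempty, so that there is at least one factor. An empty product
  would be the unit ideal, which is not proper.\<close>
definition is_product_of_ideals ::
  "('a, 'b) ring_scheme \<Rightarrow> ('a set \<Rightarrow> bool) \<Rightarrow> 'a set \<Rightarrow> bool"
  where "is_product_of_ideals R P I \<longleftrightarrow>
    (\<exists>Js. Js \<noteq> [] \<and> (\<forall>J \<in> set Js. P J) \<and> I = foldr (ideal_prod R) Js (carrier R))"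

locale OAF_ring = nonzero_cring +
  assumes OA_factorization: "\<lbrakk>ideal I R; I \<noteq> carrier R\<rbrakk> \<Longrightarrow>
    is_product_of_ideals R (\<lambda>J. OA_ideal J R) I"

locale general_ZPI_ring = nonzero_cring +
  assumes prime_factorization: "\<lbrakk>ideal I R; I \<noteq> carrier R\<rbrakk> \<Longrightarrow>
    is_product_of_ideals R (\<lambda>J. primeideal J R) I"

end

theory Submission
  imports Defs
begin

text \<open>A 1-absorbing prime ideal is prime as soon as \<open>\<one>\<close> is a sum of two nonunits (that is, unless
  the ring is local), and in a direct product \<open>(\<one>, \<zero>) + (\<zero>, \<one>)\<close> is such a sum. Hence the first two
  conditions agree. Prime factorization passes to homomorphic images, because every factor of a
  preimage contains the kernel. Conversely, the two projections have idempotent kernels, so taking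
  preimages along them is multiplicative, and every ideal of the direct product is the product of
  the preimages of its two projections.\<close>

section \<open>1-absorbing prime ideals versus prime ideals\<close>

lemma primeideal_imp_OA_ideal:
  assumes "primeideal I R" shows "OA_ideal I R"
proof -
  interpret primeideal I R by fact
  show ?thesis
    by unfold_locales (use I_notcarr I_prime in auto)
qed

text \<open>If \<open>a \<otimes> b \<in> I\<close> and \<open>b \<notin> I\<close>, absorption puts
  every nonunit multiple of \<open>a\<close> into \<open>I\<close>; adding the multiples by
  \<open>e\<close> and \<open>f\<close> recovers \<open>a\<close> itself.\<close>

lemma (in cring) OA_ideal_imp_primeideal:
  assumes "OA_ideal I R"
    and e: "e \<in> carrier R - Units R" and f: "f \<in> carrier R - Units R" and ef: "e \<oplus> f = \<one>"
  shows "primeideal I R"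
proof -
  interpret I: OA_ideal I R by fact
  \<comment> \<open>Absorption speaks of nonunits only, so the case of a unit factor is settled
    separately by cancelling it.\<close>
  have unit_cancel: "y \<in> I" if "x \<in> Units R" "y \<in> carrier R" "x \<otimes> y \<in> I" for x y
  proof -
    have "y = inv x \<otimes> (x \<otimes> y)"
      using that by (simp add: m_assoc[symmetric] Units_closed)
    also have "\<dots> \<in> I"
      by (rule I.I_l_closed[OF that(3) Units_inv_closed[OF that(1)]])
    finally show ?thesis .
  qed
  show ?thesis
  proof (rule primeidealI)
    show "ideal I R" by (rule I.ideal_axioms)
    show "cring R" by (rule cring_axioms)
    show "carrier R \<noteq> I" by (rule I.I_notcarr)
  next
    fix a b assume a: "a \<in> carrier R" and b: "b \<in> carrier R" and ab: "a \<otimes> b \<in> I"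
    show "a \<in> I \<or> b \<in> I"
    proof (cases "a \<in> Units R \<or> b \<in> Units R")
      case True
      then show ?thesis using unit_cancel[of a b] unit_cancel[of b a] a b ab by (auto simp: m_comm)
    next
      case False
      \<comment> \<open>The nonunit \<open>d\<close> serves as the extra first factor: absorption
        for \<open>d\<close>, \<open>a\<close>, \<open>b\<close> leaves
        \<open>d \<otimes> a \<in> I\<close>, since \<open>b\<close> is excluded.\<close>
      have mult_a: "d \<otimes> a \<in> I" if d: "d \<in> carrier R - Units R" and "b \<notin> I" for d
      proof -
        have "d \<otimes> a \<otimes> b \<in> I"
          using I.I_l_closed[OF ab, of d] d a b by (simp add: m_assoc)
        then show ?thesis
          using I.I_absorbing[of d a b] d a b False that(2) by blast
      qed
      have "a \<in> I" if "b \<notin> I"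
      proof -
        have "e \<otimes> a \<oplus> f \<otimes> a \<in> I"
          using mult_a e f that by (intro I.a_closed) auto
        also have "e \<otimes> a \<oplus> f \<otimes> a = (e \<oplus> f) \<otimes> a"
          using e f a by (simp add: l_distr)
        finally show ?thesis using ef a by simp
      qed
      then show ?thesis by blast
    qed
  qed
qed

section \<open>Products of finite lists of ideals\<close>

lemma (in ring) ideal_foldr_ideal_prod:
  assumes "\<forall>J \<in> set Js. ideal J R"
  shows "ideal (foldr (ideal_prod R) Js (carrier R)) R"
  using assms by (induction Js) (auto intro: oneideal ideal_prod_is_ideal)

text \<open>A product of two ideals lies in their intersection. This later forces every factor of a
  preimage to contain the kernel.\<close>

lemma (in ring) foldr_ideal_prod_subset:
  assumes "\<forall>J \<in> set Js. ideal J R" and "K \<in> set Js"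
  shows "foldr (ideal_prod R) Js (carrier R) \<subseteq> K"
  using assms
proof (induction Js)
  case (Cons J Js)
  then have "foldr (ideal_prod R) (J # Js) (carrier R) \<subseteq> J \<inter> foldr (ideal_prod R) Js (carrier R)"
    using ideal_prod_inter[of J] ideal_foldr_ideal_prod[of Js] by simp
  with Cons show ?case by auto
qed simp

text \<open>Serves to concatenate the factorizations of two ideals into one of their product; the
  induction step is associativity of the ideal product.\<close>

lemma (in cring) foldr_ideal_prod_append:
  assumes "\<forall>J \<in> set Js \<union> set Ks. ideal J R"
  shows "foldr (ideal_prod R) (Js @ Ks) (carrier R) =
    foldr (ideal_prod R) Js (carrier R) \<cdot> foldr (ideal_prod R) Ks (carrier R)"
  using assms
proof (induction Js)
  case Nil
  then have "ideal (foldr (ideal_prod R) Ks (carrier R)) R"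
    by (simp add: ideal_foldr_ideal_prod)
  then show ?case
    using ideal_prod_one ideal_prod_commute[OF _ oneideal] by simp
next
  case (Cons J Js)
  then show ?case
    using ideal_prod_assoc[of J] ideal_foldr_ideal_prod[of Js] ideal_foldr_ideal_prod[of Ks] by simp
qed

text \<open>Admitting the unit ideal together with the empty product removes all case distinctions.\<close>

lemma (in nonzero_cring) general_ZPI_ring_iff:
  "general_ZPI_ring R \<longleftrightarrow> (\<forall>I. ideal I R \<longrightarrow>
    (\<exists>Js. (\<forall>J \<in> set Js. primeideal J R) \<and> I = foldr (ideal_prod R) Js (carrier R)))"
  (is "_ \<longleftrightarrow> (\<forall>I. _ \<longrightarrow> ?factors I)")
proof
  assume "general_ZPI_ring R"
  then interpret general_ZPI_ring R .
  have "?factors (carrier R)"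
    by (rule exI[of _ "[]"]) simp
  then show "\<forall>I. ideal I R \<longrightarrow> ?factors I"
    using prime_factorization unfolding is_product_of_ideals_def by metis
next
  assume factors: "\<forall>I. ideal I R \<longrightarrow> ?factors I"
  show "general_ZPI_ring R"
  proof
    fix I assume "ideal I R" and proper: "I \<noteq> carrier R"
    with factors obtain Js where Js: "\<forall>J \<in> set Js. primeideal J R"
      "I = foldr (ideal_prod R) Js (carrier R)" by blast
    with proper have "Js \<noteq> []" by auto
    with Js show "is_product_of_ideals R (\<lambda>J. primeideal J R) I"
      unfolding is_product_of_ideals_def by blast
  qed
qed

section \<open>Images of ideals and of prime factorizations under ring homomorphisms\<close>

text \<open>The ideal product is generated inductively from products of elements by sums, and
  \<open>h\<close> commutes with both operations; each inclusion is an induction over this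
  generation.\<close>

lemma (in ring_hom_ring) image_ideal_prod:
  assumes "ideal I R" and "ideal J R"
  shows "h ` (I \<cdot>\<^bsub>R\<^esub> J) = (h ` I) \<cdot>\<^bsub>S\<^esub> (h ` J)"
proof
  note carr = ideal.Icarr[OF assms(1)] ideal.Icarr[OF assms(2)]
  have prod_carr: "x \<in> carrier R" if "x \<in> I \<cdot>\<^bsub>R\<^esub> J" for x
    using R.ideal_prod_in_carrier[OF assms] that by blast
  have "h x \<in> (h ` I) \<cdot>\<^bsub>S\<^esub> (h ` J)" if "x \<in> I \<cdot>\<^bsub>R\<^esub> J" for x
    using that
    by induction (auto simp: carr prod_carr intro: ideal_prod.intros)
  then show "h ` (I \<cdot>\<^bsub>R\<^esub> J) \<subseteq> (h ` I) \<cdot>\<^bsub>S\<^esub> (h ` J)" by blast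
  have "y \<in> h ` (I \<cdot>\<^bsub>R\<^esub> J)" if "y \<in> (h ` I) \<cdot>\<^bsub>S\<^esub> (h ` J)" for y
    using that
  proof induction
    case (prod i j)
    then obtain i' j' where ij: "i' \<in> I" "j' \<in> J" "i = h i'" "j = h j'" by blast
    then have "i \<otimes>\<^bsub>S\<^esub> j = h (i' \<otimes> j')" by (simp add: carr)
    with ij show ?case by (auto intro: ideal_prod.prod)
  next
    case (sum s t)
    then obtain s' t' where st: "s' \<in> I \<cdot>\<^bsub>R\<^esub> J" "t' \<in> I \<cdot>\<^bsub>R\<^esub> J" "s = h s'" "t = h t'" by blast
    then have "s \<oplus>\<^bsub>S\<^esub> t = h (s' \<oplus> t')" by (simp add: prod_carr)
    with st show ?case by (auto intro: ideal_prod.sum)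
  qed
  then show "(h ` I) \<cdot>\<^bsub>S\<^esub> (h ` J) \<subseteq> h ` (I \<cdot>\<^bsub>R\<^esub> J)" by blast
qed

text \<open>Surjectivity settles the empty product, where the image of \<open>carrier R\<close> has
  to be \<open>carrier S\<close>.\<close>

lemma (in ring_hom_ring) image_foldr_ideal_prod:
  assumes "h ` carrier R = carrier S" and "\<forall>J \<in> set Js. ideal J R"
  shows "h ` foldr (ideal_prod R) Js (carrier R) =
    foldr (ideal_prod S) (map ((`) h) Js) (carrier S)"
  using assms(2)
  by (induction Js) (simp_all add: assms(1) image_ideal_prod R.ideal_foldr_ideal_prod)

lemma (in ring_hom_ring) surj_image_ideal:
  assumes surj: "h ` carrier R = carrier S" and "ideal I R"
  shows "ideal (h ` I) S"
proof (rule idealI)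
  interpret I: ideal I R by fact
  show "ring S" by (rule S.ring_axioms)
  show "subgroup (h ` I) (add_monoid S)"
    using img_is_add_subgroup I.a_subgroup by blast
  fix a x assume a: "a \<in> h ` I" and "x \<in> carrier S"
  then obtain i r where "i \<in> I" "a = h i" "r \<in> carrier R" "x = h r"
    using surj by blast
  moreover from this have "x \<otimes>\<^bsub>S\<^esub> a = h (r \<otimes> i)" "a \<otimes>\<^bsub>S\<^esub> x = h (i \<otimes> r)"
    by (simp_all add: I.Icarr)
  ultimately show "x \<otimes>\<^bsub>S\<^esub> a \<in> h ` I" "a \<otimes>\<^bsub>S\<^esub> x \<in> h ` I"
    using I.I_l_closed[of i r] I.I_r_closed[of i r] by (simp_all only: imageI)
qed

text \<open>An element of \<open>I\<close> with the same image as \<open>x\<close> differs from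
  \<open>x\<close> by an element of the kernel, hence of \<open>I\<close>. An ideal containing the
  kernel is thus determined by its image.\<close>

lemma (in ring_hom_ring) mem_if_image_mem:
  assumes "ideal I R" and ker: "a_kernel R S h \<subseteq> I"
    and x: "x \<in> carrier R" and "h x \<in> h ` I"
  shows "x \<in> I"
proof -
  interpret I: ideal I R by fact
  obtain i where i: "i \<in> I" "h x = h i" using assms(4) by (rule imageE)
  note i_carr = I.Icarr[OF i(1)]
  have "h (x \<ominus> i) = h i \<ominus>\<^bsub>S\<^esub> h i"
    using x i_carr by (simp add: R.minus_eq S.minus_eq i(2))
  also have "\<dots> = \<zero>\<^bsub>S\<^esub>"
    using i_carr by (simp add: S.minus_eq S.r_neg)
  finally have "x \<ominus> i \<in> a_kernel R S h"
    unfolding a_kernel_def' using x i_carr R.minus_closed by blast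
  with ker have "x \<ominus> i \<in> I" ..
  then have "x \<ominus> i \<oplus> i \<in> I" using i(1) by (rule I.a_closed)
  also have "x \<ominus> i \<oplus> i = x"
    using x i_carr by (simp add: R.minus_eq R.a_assoc R.l_neg)
  finally show ?thesis .
qed

lemma (in ring_hom_ring) surj_image_vimage_ideal:
  assumes surj: "h ` carrier R = carrier S" and I: "ideal I S"
  shows "h ` {r \<in> carrier R. h r \<in> I} = I"
proof
  show "I \<subseteq> h ` {r \<in> carrier R. h r \<in> I}"
  proof
    fix y assume y: "y \<in> I"
    then have "y \<in> h ` carrier R" using surj ideal.Icarr[OF I] by simp
    then obtain x where "x \<in> carrier R" "y = h x" by (rule imageE)
    with y show "y \<in> h ` {r \<in> carrier R. h r \<in> I}" by simp
  qed
qed auto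

lemma (in ring_hom_ring) kernel_subset_vimage_ideal:
  assumes "ideal I S"
  shows "a_kernel R S h \<subseteq> {r \<in> carrier R. h r \<in> I}"
proof
  fix x assume "x \<in> a_kernel R S h"
  then have "x \<in> carrier R" "h x = \<zero>\<^bsub>S\<^esub>" unfolding a_kernel_def' by simp_all
  then show "x \<in> {r \<in> carrier R. h r \<in> I}"
    using additive_subgroup.zero_closed[OF ideal.axioms(1)[OF assms]] by simp
qed

text \<open>Since \<open>P\<close> contains the kernel, membership of \<open>h x\<close> in the
  image of \<open>P\<close> is the same as \<open>x \<in> P\<close>; properness and primality
  therefore carry over along lifts of elements of \<open>S\<close>.\<close>

lemma (in ring_hom_ring) surj_image_primeideal:
  assumes surj: "h ` carrier R = carrier S" and "cring S"
    and "primeideal P R" and ker: "a_kernel R S h \<subseteq> P"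
  shows "primeideal (h ` P) S"
proof (rule primeidealI)
  interpret P: primeideal P R by fact
  note mem = mem_if_image_mem[OF P.ideal_axioms ker]
  show "ideal (h ` P) S" by (rule surj_image_ideal[OF surj P.ideal_axioms])
  show "cring S" by fact
  show "carrier S \<noteq> h ` P"
  proof
    assume "carrier S = h ` P"
    then have "h \<one> \<in> h ` P" using surj hom_closed[OF R.one_closed] by (simp only:)
    then have "\<one> \<in> P" by (rule mem[OF R.one_closed])
    with P.one_imp_carrier P.I_notcarr show False by simp
  qed
  fix a b assume "a \<in> carrier S" "b \<in> carrier S" and ab: "a \<otimes>\<^bsub>S\<^esub> b \<in> h ` P"
  then obtain x y where xy: "x \<in> carrier R" "y \<in> carrier R" "a = h x" "b = h y"
    using surj by blast
  with ab mem[of "x \<otimes> y"] have "x \<otimes> y \<in> P" by simp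
  with xy P.I_prime[of x y] show "a \<in> h ` P \<or> b \<in> h ` P" by blast
qed

text \<open>Factor the preimage of the given ideal in \<open>R\<close> and apply \<open>h\<close> to
  every factor.\<close>

lemma (in ring_hom_ring) general_ZPI_ring_surj_image:
  assumes "general_ZPI_ring R" and "nonzero_cring S" and surj: "h ` carrier R = carrier S"
  shows "general_ZPI_ring S"
proof -
  interpret ZR: general_ZPI_ring R by fact
  interpret NS: nonzero_cring S by fact
  have "\<exists>Js. (\<forall>J \<in> set Js. primeideal J S) \<and> I = foldr (ideal_prod S) Js (carrier S)"
    if I: "ideal I S" for I
  proof -
    let ?A = "{r \<in> carrier R. h r \<in> I}"
    obtain Js where prime: "\<forall>J \<in> set Js. primeideal J R"
      and A: "?A = foldr (ideal_prod R) Js (carrier R)"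
      using ZR.general_ZPI_ring_iff[THEN iffD1, OF ZR.general_ZPI_ring_axioms,
          rule_format, OF ideal_vimage[OF I]] by blast
    have ideals: "\<forall>J \<in> set Js. ideal J R"
      using prime primeideal.axioms(1) by blast
    \<comment> \<open>The kernel lies in the preimage \<open>?A\<close>, and \<open>?A\<close>,
      being the product of \<open>Js\<close>, lies in each factor. This makes the images of the
      factors prime.\<close>
    have "a_kernel R S h \<subseteq> J" if "J \<in> set Js" for J
      using kernel_subset_vimage_ideal[OF I] R.foldr_ideal_prod_subset[OF ideals that]
      unfolding A by (rule subset_trans)
    then have "\<forall>J \<in> set (map ((`) h) Js). primeideal J S"
      using prime surj_image_primeideal[OF surj NS.cring_axioms] by simp
    moreover have "I = foldr (ideal_prod S) (map ((`) h) Js) (carrier S)"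
      using image_foldr_ideal_prod[OF surj ideals, folded A]
      unfolding surj_image_vimage_ideal[OF surj I] .
    ultimately show ?thesis by blast
  qed
  then show ?thesis by (simp add: NS.general_ZPI_ring_iff)
qed

section \<open>Preimages of factorizations along a surjection with idempotent kernel\<close>

text \<open>Both sides have the image \<open>I \<cdot> J\<close>, so they agree once the right side
  contains the kernel. Idempotence gives this: the kernel lies in its own square, and the square
  lies in the product of the two preimages.\<close>

lemma (in ring_hom_ring) vimage_ideal_prod:
  assumes surj: "h ` carrier R = carrier S"
    and idem: "a_kernel R S h \<subseteq> a_kernel R S h \<cdot>\<^bsub>R\<^esub> a_kernel R S h"
    and I: "ideal I S" and J: "ideal J S"
  shows "{r \<in> carrier R. h r \<in> I \<cdot>\<^bsub>S\<^esub> J} =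
    {r \<in> carrier R. h r \<in> I} \<cdot>\<^bsub>R\<^esub> {r \<in> carrier R. h r \<in> J}"
    (is "?L = ?A \<cdot>\<^bsub>R\<^esub> ?B")
proof -
  have ideals: "ideal ?A R" "ideal ?B R"
    using I J by (simp_all add: ideal_vimage)
  note images = surj_image_vimage_ideal[OF surj I] surj_image_vimage_ideal[OF surj J]
  have image: "h ` (?A \<cdot>\<^bsub>R\<^esub> ?B) = I \<cdot>\<^bsub>S\<^esub> J"
    using image_ideal_prod[OF ideals] images by simp
  note ker = kernel_subset_vimage_ideal[OF I] kernel_subset_vimage_ideal[OF J]
  \<comment> \<open>Monotonicity of the ideal product, as the kernel is contained in both
    \<open>?A\<close> and \<open>?B\<close>.\<close>
  have "x \<in> ?A \<cdot>\<^bsub>R\<^esub> ?B" if "x \<in> a_kernel R S h \<cdot>\<^bsub>R\<^esub> a_kernel R S h" for x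
    using that
  proof induction
    case (prod i j)
    then show ?case using ker by (intro ideal_prod.prod) blast+
  next
    case (sum s t)
    then show ?case by (intro ideal_prod.sum)
  qed
  with idem have "a_kernel R S h \<subseteq> ?A \<cdot>\<^bsub>R\<^esub> ?B" by blast
  from mem_if_image_mem[OF R.ideal_prod_is_ideal[OF ideals] this]
  have "?L \<subseteq> ?A \<cdot>\<^bsub>R\<^esub> ?B" unfolding image by blast
  moreover have "?A \<cdot>\<^bsub>R\<^esub> ?B \<subseteq> ?L"
    unfolding image[symmetric] using R.ideal_prod_in_carrier[OF ideals] by blast
  ultimately show ?thesis by blast
qed

lemma (in ring_hom_ring) vimage_foldr_ideal_prod:
  assumes "h ` carrier R = carrier S"
    and "a_kernel R S h \<subseteq> a_kernel R S h \<cdot>\<^bsub>R\<^esub> a_kernel R S h"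
    and "\<forall>J \<in> set Js. ideal J S"
  shows "{r \<in> carrier R. h r \<in> foldr (ideal_prod S) Js (carrier S)} =
    foldr (ideal_prod R) (map (\<lambda>J. {r \<in> carrier R. h r \<in> J}) Js) (carrier R)"
  using assms(3)
  by (induction Js) (auto simp: vimage_ideal_prod[OF assms(1,2)] S.ideal_foldr_ideal_prod)

text \<open>Preimages of primes are prime, and here preimages respect products. The list may be
  empty because \<open>I\<close> may be the unit ideal.\<close>

lemma (in ring_hom_ring) vimage_prime_factorization:
  assumes "cring R" and "general_ZPI_ring S" and "h ` carrier R = carrier S"
    and "a_kernel R S h \<subseteq> a_kernel R S h \<cdot>\<^bsub>R\<^esub> a_kernel R S h"
    and "ideal I S"
  shows "\<exists>Js. (\<forall>J \<in> set Js. primeideal J R) \<and>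
    {r \<in> carrier R. h r \<in> I} = foldr (ideal_prod R) Js (carrier R)"
proof -
  interpret ZS: general_ZPI_ring S by fact
  obtain Js where Js: "\<forall>J \<in> set Js. primeideal J S" "I = foldr (ideal_prod S) Js (carrier S)"
    using ZS.general_ZPI_ring_iff[THEN iffD1, OF ZS.general_ZPI_ring_axioms,
        rule_format, OF assms(5)] by blast
  have "\<forall>J \<in> set Js. ideal J S"
    using Js(1) primeideal.axioms(1) by blast
  then have "{r \<in> carrier R. h r \<in> I} =
      foldr (ideal_prod R) (map (\<lambda>J. {r \<in> carrier R. h r \<in> J}) Js) (carrier R)"
    using vimage_foldr_ideal_prod[OF assms(3,4)] Js(2) by simp
  moreover have "\<forall>J \<in> set (map (\<lambda>J. {r \<in> carrier R. h r \<in> J}) Js). primeideal J R"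
    using Js(1) primeideal_vimage[OF assms(1)] by simp
  ultimately show ?thesis by blast
qed

section \<open>The direct product, its projections and its ideals\<close>

lemma RDirProd_simps:
  "(a, b) \<otimes>\<^bsub>RDirProd R S\<^esub> (c, d) = (a \<otimes>\<^bsub>R\<^esub> c, b \<otimes>\<^bsub>S\<^esub> d)"
  "(a, b) \<oplus>\<^bsub>RDirProd R S\<^esub> (c, d) = (a \<oplus>\<^bsub>R\<^esub> c, b \<oplus>\<^bsub>S\<^esub> d)"
  "\<one>\<^bsub>RDirProd R S\<^esub> = (\<one>\<^bsub>R\<^esub>, \<one>\<^bsub>S\<^esub>)"
  "\<zero>\<^bsub>RDirProd R S\<^esub> = (\<zero>\<^bsub>R\<^esub>, \<zero>\<^bsub>S\<^esub>)"
  by (simp_all add: RDirProd_def DirProd_def monoid.defs)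

lemma RDirProd_nonzero_cring:
  assumes "nonzero_cring R" and "cring S"
  shows "nonzero_cring (RDirProd R S)"
proof -
  interpret R: nonzero_cring R by fact
  interpret S: cring S by fact
  interpret ring "RDirProd R S"
    by (rule RDirProd_ring[OF R.ring_axioms S.ring_axioms])
  show ?thesis
    by unfold_locales
      (auto simp: RDirProd_simps RDirProd_carrier R.m_comm S.m_comm R.one_not_zero)
qed

lemma RDirProd_fst_hom:
  assumes "ring R" and "ring S"
  shows "ring_hom_ring (RDirProd R S) R fst"
  by (rule ring_hom_ringI[OF RDirProd_ring[OF assms] assms(1)])
    (auto simp: RDirProd_simps RDirProd_carrier)

lemma RDirProd_snd_hom:
  assumes "ring R" and "ring S"
  shows "ring_hom_ring (RDirProd R S) S snd"
  by (rule ring_hom_ringI[OF RDirProd_ring[OF assms] assms(2)])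
    (auto simp: RDirProd_simps RDirProd_carrier)

lemma RDirProd_fst_image:
  assumes "ring S"
  shows "fst ` carrier (RDirProd R S) = carrier R"
  \<comment> \<open>The zero of \<open>S\<close> fills the second coordinate of a lift.\<close>
  using ring.ring_simprules(2)[OF assms] by (auto simp: RDirProd_carrier image_iff)

lemma RDirProd_snd_image:
  assumes "ring R"
  shows "snd ` carrier (RDirProd R S) = carrier S"
  using ring.ring_simprules(2)[OF assms] by (auto simp: RDirProd_carrier image_iff)

text \<open>The idempotent (0, 1) lies in the kernel and acts on it as an identity, so every element
  of the kernel is its own product with (0, 1).\<close>

lemma RDirProd_fst_kernel_idem:
  assumes "ring R" and "ring S"
  defines "K \<equiv> a_kernel (RDirProd R S) R fst"
  shows "K \<subseteq> K \<cdot>\<^bsub>RDirProd R S\<^esub> K"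
proof
  interpret R: ring R by fact
  interpret S: ring S by fact
  fix x assume "x \<in> K"
  then obtain y where y: "y \<in> carrier S" "x = (\<zero>\<^bsub>R\<^esub>, y)"
    by (auto simp: K_def a_kernel_def' RDirProd_carrier)
  then have "x = (\<zero>\<^bsub>R\<^esub>, y) \<otimes>\<^bsub>RDirProd R S\<^esub> (\<zero>\<^bsub>R\<^esub>, \<one>\<^bsub>S\<^esub>)"
    by (simp add: RDirProd_simps)
  moreover have "(\<zero>\<^bsub>R\<^esub>, y) \<in> K" "(\<zero>\<^bsub>R\<^esub>, \<one>\<^bsub>S\<^esub>) \<in> K"
    using y by (simp_all add: K_def a_kernel_def' RDirProd_carrier)
  ultimately show "x \<in> K \<cdot>\<^bsub>RDirProd R S\<^esub> K"
    by (metis ideal_prod.prod)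
qed

lemma RDirProd_snd_kernel_idem:
  assumes "ring R" and "ring S"
  defines "K \<equiv> a_kernel (RDirProd R S) S snd"
  shows "K \<subseteq> K \<cdot>\<^bsub>RDirProd R S\<^esub> K"
proof
  interpret R: ring R by fact
  interpret S: ring S by fact
  fix x assume "x \<in> K"
  then obtain y where y: "y \<in> carrier R" "x = (y, \<zero>\<^bsub>S\<^esub>)"
    by (auto simp: K_def a_kernel_def' RDirProd_carrier)
  then have "x = (y, \<zero>\<^bsub>S\<^esub>) \<otimes>\<^bsub>RDirProd R S\<^esub> (\<one>\<^bsub>R\<^esub>, \<zero>\<^bsub>S\<^esub>)"
    by (simp add: RDirProd_simps)
  moreover have "(y, \<zero>\<^bsub>S\<^esub>) \<in> K" "(\<one>\<^bsub>R\<^esub>, \<zero>\<^bsub>S\<^esub>) \<in> K"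
    using y by (simp_all add: K_def a_kernel_def' RDirProd_carrier)
  ultimately show "x \<in> K \<cdot>\<^bsub>RDirProd R S\<^esub> K"
    by (metis ideal_prod.prod)
qed

text \<open>With I1 and I2 the projections of \<open>I\<close>, the two factors are I1 x
  \<open>S\<close> and \<open>R\<close> x I2. This reduces factoring \<open>I\<close> to factoring
  I1 and I2.\<close>

lemma RDirProd_ideal_eq_prod:
  assumes "ring R" and "ring S" and "ideal I (RDirProd R S)"
  shows "I = {r \<in> carrier (RDirProd R S). fst r \<in> fst ` I} \<cdot>\<^bsub>RDirProd R S\<^esub>
    {r \<in> carrier (RDirProd R S). snd r \<in> snd ` I}" (is "I = ?A \<cdot>\<^bsub>?D\<^esub> ?B")
proof
  interpret R: ring R by fact
  interpret S: ring S by fact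
  interpret I: ideal I ?D by fact
  have carr: "x \<in> carrier R" "y \<in> carrier S" if "(x, y) \<in> I" for x y
    using I.Icarr[OF that] by (simp_all add: RDirProd_carrier)
  show "I \<subseteq> ?A \<cdot>\<^bsub>?D\<^esub> ?B"
  proof
    fix z assume z: "z \<in> I"
    obtain x y where xy: "z = (x, y)" by (cases z)
    have "x \<in> fst ` I" "y \<in> snd ` I"
      using imageI[OF z, of fst] imageI[OF z, of snd] by (simp_all add: xy)
    \<comment> \<open>The coordinate that each factor leaves free is filled with 1, so that the
      product of the two pairs is \<open>(x, y)\<close>.\<close>
    then have "(x, \<one>\<^bsub>S\<^esub>) \<in> ?A" "(\<one>\<^bsub>R\<^esub>, y) \<in> ?B"
      using z carr[of x y] by (simp_all add: xy RDirProd_carrier)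
    then have "(x, \<one>\<^bsub>S\<^esub>) \<otimes>\<^bsub>?D\<^esub> (\<one>\<^bsub>R\<^esub>, y) \<in> ?A \<cdot>\<^bsub>?D\<^esub> ?B"
      by (rule ideal_prod.prod)
    then show "z \<in> ?A \<cdot>\<^bsub>?D\<^esub> ?B"
      using z carr[of x y] by (simp add: xy RDirProd_simps)
  qed
  show "?A \<cdot>\<^bsub>?D\<^esub> ?B \<subseteq> I"
  proof
    fix z assume "z \<in> ?A \<cdot>\<^bsub>?D\<^esub> ?B"
    then show "z \<in> I"
    proof induction
      case (prod i j)
      obtain a b c d where ij: "i = (a, b)" "j = (c, d)"
        by (metis surj_pair)
      with prod have "a \<in> fst ` I" "d \<in> snd ` I"
        and abcd: "i = (a, b)" "j = (c, d)" "b \<in> carrier S" "c \<in> carrier R"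
        by (simp_all add: RDirProd_carrier)
      then obtain u v where uv: "(a, u) \<in> I" "(v, d) \<in> I"
        by (metis imageE prod.collapse)
      \<comment> \<open>Only \<open>(a, u)\<close> and \<open>(v, d)\<close> are known to lie in
        \<open>I\<close>, with uncontrolled \<open>u\<close> and \<open>v\<close>. Multiplying by
        \<open>(c, \<zero>)\<close> and \<open>(\<zero>, b)\<close> kills these coordinates, and the
        two results add up to \<open>i\<close> times \<open>j\<close>.\<close>
      have "(a, u) \<otimes>\<^bsub>?D\<^esub> (c, \<zero>\<^bsub>S\<^esub>) \<in> I" "(\<zero>\<^bsub>R\<^esub>, b) \<otimes>\<^bsub>?D\<^esub> (v, d) \<in> I"
        using abcd I.I_r_closed[OF uv(1)] I.I_l_closed[OF uv(2)] by (simp_all add: RDirProd_carrier)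
      then have "(a, u) \<otimes>\<^bsub>?D\<^esub> (c, \<zero>\<^bsub>S\<^esub>) \<oplus>\<^bsub>?D\<^esub> (\<zero>\<^bsub>R\<^esub>, b) \<otimes>\<^bsub>?D\<^esub> (v, d) \<in> I"
        by simp
      then show ?case
        using abcd carr[OF uv(1)] carr[OF uv(2)] by (simp add: RDirProd_simps)
    next
      case (sum s t)
      then show ?case by simp
    qed
  qed
qed

section \<open>Factorization conditions on the direct product\<close>

text \<open>The projections of an ideal factor into primes, these factorizations pull back along the
  projections, and the concatenated lists factor the ideal.\<close>

lemma RDirProd_general_ZPI_ring:
  assumes "general_ZPI_ring R" and "general_ZPI_ring S"
  shows "general_ZPI_ring (RDirProd R S)"
proof -
  interpret R: general_ZPI_ring R by fact
  interpret S: general_ZPI_ring S by fact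
  let ?D = "RDirProd R S"
  interpret D: nonzero_cring ?D
    by (rule RDirProd_nonzero_cring[OF R.nonzero_cring_axioms S.cring_axioms])
  interpret fst: ring_hom_ring ?D R fst
    by (rule RDirProd_fst_hom[OF R.ring_axioms S.ring_axioms])
  interpret snd: ring_hom_ring ?D S snd
    by (rule RDirProd_snd_hom[OF R.ring_axioms S.ring_axioms])
  have "\<exists>Js. (\<forall>J \<in> set Js. primeideal J ?D) \<and> I = foldr (ideal_prod ?D) Js (carrier ?D)"
    if I: "ideal I ?D" for I
  proof -
    note surj = RDirProd_fst_image[OF S.ring_axioms, of R] RDirProd_snd_image[OF R.ring_axioms, of S]
    obtain Js where Js: "\<forall>J \<in> set Js. primeideal J ?D"
      "{r \<in> carrier ?D. fst r \<in> fst ` I} = foldr (ideal_prod ?D) Js (carrier ?D)"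
      using fst.vimage_prime_factorization[OF D.cring_axioms assms(1) surj(1)
          RDirProd_fst_kernel_idem[OF R.ring_axioms S.ring_axioms] fst.surj_image_ideal[OF surj(1) I]]
      by blast
    obtain Ks where Ks: "\<forall>J \<in> set Ks. primeideal J ?D"
      "{r \<in> carrier ?D. snd r \<in> snd ` I} = foldr (ideal_prod ?D) Ks (carrier ?D)"
      using snd.vimage_prime_factorization[OF D.cring_axioms assms(2) surj(2)
          RDirProd_snd_kernel_idem[OF R.ring_axioms S.ring_axioms] snd.surj_image_ideal[OF surj(2) I]]
      by blast
    have "\<forall>J \<in> set Js \<union> set Ks. ideal J ?D"
      using Js(1) Ks(1) primeideal.axioms(1) by blast
    then have "I = foldr (ideal_prod ?D) (Js @ Ks) (carrier ?D)"
      using RDirProd_ideal_eq_prod[OF R.ring_axioms S.ring_axioms I] Js(2) Ks(2)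
        D.foldr_ideal_prod_append by simp
    moreover have "\<forall>J \<in> set (Js @ Ks). primeideal J ?D"
      using Js(1) Ks(1) by auto
    ultimately show ?thesis by blast
  qed
  then show ?thesis by (simp add: D.general_ZPI_ring_iff)
qed

text \<open>As both rings are nonzero, (1, 0) and (0, 1) are nonunits with sum 1, so the criterion
  for primality applies.\<close>

lemma RDirProd_OA_ideal_iff_primeideal:
  assumes "nonzero_cring R" and "nonzero_cring S"
  shows "OA_ideal I (RDirProd R S) \<longleftrightarrow> primeideal I (RDirProd R S)"
proof
  interpret R: nonzero_cring R by fact
  interpret S: nonzero_cring S by fact
  let ?D = "RDirProd R S"
  interpret D: nonzero_cring ?D
    by (rule RDirProd_nonzero_cring[OF R.nonzero_cring_axioms S.cring_axioms])
  \<comment> \<open>In the second coordinate an inverse would give \<open>\<zero> = \<one>\<close>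
    in \<open>S\<close>.\<close>
  have "(\<one>\<^bsub>R\<^esub>, \<zero>\<^bsub>S\<^esub>) \<notin> Units ?D"
  proof
    assume "(\<one>\<^bsub>R\<^esub>, \<zero>\<^bsub>S\<^esub>) \<in> Units ?D"
    then obtain c d where "d \<in> carrier S" "(c, d) \<otimes>\<^bsub>?D\<^esub> (\<one>\<^bsub>R\<^esub>, \<zero>\<^bsub>S\<^esub>) = \<one>\<^bsub>?D\<^esub>"
      unfolding Units_def RDirProd_carrier by blast
    then show False using S.one_not_zero by (simp add: RDirProd_simps)
  qed
  moreover have "(\<zero>\<^bsub>R\<^esub>, \<one>\<^bsub>S\<^esub>) \<notin> Units ?D"
  proof
    assume "(\<zero>\<^bsub>R\<^esub>, \<one>\<^bsub>S\<^esub>) \<in> Units ?D"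
    then obtain c d where "c \<in> carrier R" "(c, d) \<otimes>\<^bsub>?D\<^esub> (\<zero>\<^bsub>R\<^esub>, \<one>\<^bsub>S\<^esub>) = \<one>\<^bsub>?D\<^esub>"
      unfolding Units_def RDirProd_carrier by blast
    then show False using R.one_not_zero by (simp add: RDirProd_simps)
  qed
  moreover have "(\<one>\<^bsub>R\<^esub>, \<zero>\<^bsub>S\<^esub>) \<in> carrier ?D" "(\<zero>\<^bsub>R\<^esub>, \<one>\<^bsub>S\<^esub>) \<in> carrier ?D"
    by (simp_all add: RDirProd_carrier)
  moreover have "(\<one>\<^bsub>R\<^esub>, \<zero>\<^bsub>S\<^esub>) \<oplus>\<^bsub>?D\<^esub> (\<zero>\<^bsub>R\<^esub>, \<one>\<^bsub>S\<^esub>) = \<one>\<^bsub>?D\<^esub>"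
    by (simp add: RDirProd_simps)
  ultimately show "primeideal I ?D" if "OA_ideal I ?D"
    by (intro D.OA_ideal_imp_primeideal[OF that] DiffI)
qed (rule primeideal_imp_OA_ideal)

theorem corollary2p5:
  fixes R1 :: "('a, 'm) ring_scheme" and R2 :: "('b, 'n) ring_scheme"
  assumes "nonzero_cring R1" and "nonzero_cring R2"
  shows "(OAF_ring (RDirProd R1 R2) \<longleftrightarrow> general_ZPI_ring (RDirProd R1 R2)) \<and>
         (general_ZPI_ring (RDirProd R1 R2) \<longleftrightarrow> general_ZPI_ring R1 \<and> general_ZPI_ring R2)"
proof
  interpret R1: nonzero_cring R1 by fact
  interpret R2: nonzero_cring R2 by fact
  \<comment> \<open>The two notions differ only in the predicate on the factors, and over the direct
    product these predicates coincide.\<close>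
  show "OAF_ring (RDirProd R1 R2) \<longleftrightarrow> general_ZPI_ring (RDirProd R1 R2)"
    by (simp add: OAF_ring_def OAF_ring_axioms_def general_ZPI_ring_def general_ZPI_ring_axioms_def
        RDirProd_OA_ideal_iff_primeideal[OF assms])
  \<comment> \<open>From left to right, each ring is the image of the direct product under a
    surjective projection.\<close>
  show "general_ZPI_ring (RDirProd R1 R2) \<longleftrightarrow> general_ZPI_ring R1 \<and> general_ZPI_ring R2"
    using RDirProd_general_ZPI_ring
      ring_hom_ring.general_ZPI_ring_surj_image[OF RDirProd_fst_hom[OF R1.ring_axioms R2.ring_axioms]
        _ assms(1) RDirProd_fst_image[OF R2.ring_axioms]]
      ring_hom_ring.general_ZPI_ring_surj_image[OF RDirProd_snd_hom[OF R1.ring_axioms R2.ring_axioms]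
        _ assms(2) RDirProd_snd_image[OF R1.ring_axioms]]
    by blast
qed

end
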